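(* Let $\mathfrak{g}$ be a real metric Lie algebra with no non-zero abelian factor and with orthogonal decomposition $\mathfrak{g}=\bigoplus_{j=1}^k\mathfrak{g}_j$ into irreducible factors. For every orthogonal bi-invariant complex structure $J:\mathfrak{g}\to\mathfrak{g}$ it holds that $J(\mathfrak{g}_j)=\mathfrak{g}_j$ for all $j$, i.e. the irreducible factors $\mathfrak{g}_j$ are $J$-invariant. Moreover, the ideals $(\mathfrak{g}_j,J|_{\mathfrak{g}_j})$ are the irreducible factors of the complex metric Lie algebra $(\mathfrak{g},J)$.
   Context: All Lie algebras are finite-dimensional. A real (resp. complex) metric Lie algebra is a real (resp. complex) Lie algebra with a positive definite symmetric bilinear (resp. Hermitian, linear in the first argument) form, called the inner product. A factor is an ideal whose orthogonal complement is also an ideal; a non-zero metric Lie algebra is irreducible if its only factors are $0$ and itself. "No non-zero abelian factor" means that no non-zero factor is abelian. An orthogonal decomposition is an internal direct sum of pairwise orthogonal ideals. For a metric Lie algebra with no non-zero abelian factor, "the irreducible factors" are the summands of its orthogonal decomposition into irreducible factors. An orthogonal bi-invariant complex structure on a real metric Lie algebra $\mathfrak{g}$ is an $\mathbb{R}$-linear map $J:\mathfrak{g}\to\mathfrak{g}$ with $J^2=-\mathrm{Id}$, $J([X,Y])=[J(X),Y]$ and $\langle J(X),J(Y)\rangle=\langle X,Y\rangle$ for all $X,Y\in\mathfrak{g}$. Given such $J$, $(\mathfrak{g},J)$ denotes the complex Lie algebra with scalar multiplication $(a+bi)X=aX+bJ(X)$, equipped with the Hermitian inner product $\langle X,Y\rangle_{\mathbb{C}}=\tfrac12\left(\langle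 X,Y\rangle+i\langle X,JY\rangle\right)$. *)

theory Defs
  imports Complex_Main "HOL-Library.FuncSet"
begin

text \<open>
  The same record type serves real (\<open>'k = real\<close>) and complex (\<open>'k = complex\<close>) metric Lie algebras;
  addition is that of the type \<open>'g\<close>. The carrier is a component of its own, so that an ideal can be
  regarded as a metric Lie algebra with the restricted operations.
\<close>

record ('k, 'g) metric_lie =
  carrier :: "'g set"
  scale :: "'k \<Rightarrow> 'g \<Rightarrow> 'g"
  bracket :: "'g \<Rightarrow> 'g \<Rightarrow> 'g"
  form :: "'g \<Rightarrow> 'g \<Rightarrow> 'k"

definition lie_algebra :: "('k::field, 'g::ab_group_add) metric_lie \<Rightarrow> bool" where
  "lie_algebra M \<longleftrightarrow>
     vector_space (scale M) \<and>
     module.subspace (scale M) (carrier M) \<and>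
     (\<exists>B. finite B \<and> module.span (scale M) B = carrier M) \<and>
     (\<forall>x\<in>carrier M. \<forall>y\<in>carrier M. bracket M x y \<in> carrier M) \<and>
     (\<forall>x\<in>carrier M. \<forall>y\<in>carrier M. \<forall>z\<in>carrier M.
        bracket M (x + y) z = bracket M x z + bracket M y z \<and>
        bracket M x (y + z) = bracket M x y + bracket M x z) \<and>
     (\<forall>c. \<forall>x\<in>carrier M. \<forall>y\<in>carrier M.
        bracket M (scale M c x) y = scale M c (bracket M x y) \<and>
        bracket M x (scale M c y) = scale M c (bracket M x y)) \<and>
     (\<forall>x\<in>carrier M. bracket M x x = 0) \<and>
     (\<forall>x\<in>carrier M. \<forall>y\<in>carrier M. \<forall>z\<in>carrier M.
        bracket M x (bracket M y z) + bracket M y (bracket M z x) + bracket M z (bracket M x y) = 0)"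

text \<open>Linearity in the second argument follows from symmetry.\<close>

definition real_metric_lie_algebra :: "(real, 'g::ab_group_add) metric_lie \<Rightarrow> bool" where
  "real_metric_lie_algebra M \<longleftrightarrow>
     lie_algebra M \<and>
     (\<forall>x\<in>carrier M. \<forall>y\<in>carrier M. \<forall>z\<in>carrier M.
        form M (x + y) z = form M x z + form M y z) \<and>
     (\<forall>c. \<forall>x\<in>carrier M. \<forall>y\<in>carrier M. form M (scale M c x) y = c * form M x y) \<and>
     (\<forall>x\<in>carrier M. \<forall>y\<in>carrier M. form M y x = form M x y) \<and>
     (\<forall>x\<in>carrier M. x \<noteq> 0 \<longrightarrow> form M x x > 0)"

text \<open>
  Conjugate-linearity in the second argument, and \<open>form M x x\<close> being real, follow from Hermitian
  symmetry.
\<close>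

definition complex_metric_lie_algebra :: "(complex, 'g::ab_group_add) metric_lie \<Rightarrow> bool" where
  "complex_metric_lie_algebra M \<longleftrightarrow>
     lie_algebra M \<and>
     (\<forall>x\<in>carrier M. \<forall>y\<in>carrier M. \<forall>z\<in>carrier M.
        form M (x + y) z = form M x z + form M y z) \<and>
     (\<forall>c. \<forall>x\<in>carrier M. \<forall>y\<in>carrier M. form M (scale M c x) y = c * form M x y) \<and>
     (\<forall>x\<in>carrier M. \<forall>y\<in>carrier M. form M y x = cnj (form M x y)) \<and>
     (\<forall>x\<in>carrier M. x \<noteq> 0 \<longrightarrow> Re (form M x x) > 0)"

definition lie_ideal :: "('k::field, 'g::ab_group_add) metric_lie \<Rightarrow> 'g set \<Rightarrow> bool" where
  "lie_ideal M I \<longleftrightarrow>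
     module.subspace (scale M) I \<and> I \<subseteq> carrier M \<and>
     (\<forall>x\<in>carrier M. \<forall>y\<in>I. bracket M x y \<in> I)"

definition orth_complement :: "('k::field, 'g::ab_group_add) metric_lie \<Rightarrow> 'g set \<Rightarrow> 'g set" where
  "orth_complement M I = {x \<in> carrier M. \<forall>y\<in>I. form M x y = 0}"

definition metric_factor :: "('k::field, 'g::ab_group_add) metric_lie \<Rightarrow> 'g set \<Rightarrow> bool" where
  "metric_factor M I \<longleftrightarrow> lie_ideal M I \<and> lie_ideal M (orth_complement M I)"

definition abelian :: "('k::field, 'g::ab_group_add) metric_lie \<Rightarrow> bool" where
  "abelian M \<longleftrightarrow> (\<forall>x\<in>carrier M. \<forall>y\<in>carrier M. bracket M x y = 0)"

definition sub_metric_lie ::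
    "('k::field, 'g::ab_group_add) metric_lie \<Rightarrow> 'g set \<Rightarrow> ('k, 'g) metric_lie" where
  "sub_metric_lie M I = M\<lparr>carrier := I\<rparr>"

definition irreducible_metric_lie :: "('k::field, 'g::ab_group_add) metric_lie \<Rightarrow> bool" where
  "irreducible_metric_lie M \<longleftrightarrow>
     carrier M \<noteq> {0} \<and> (\<forall>I. metric_factor M I \<longrightarrow> I = {0} \<or> I = carrier M)"

definition no_nonzero_abelian_factor :: "('k::field, 'g::ab_group_add) metric_lie \<Rightarrow> bool" where
  "no_nonzero_abelian_factor M \<longleftrightarrow>
     (\<forall>I. metric_factor M I \<and> I \<noteq> {0} \<longrightarrow> \<not> abelian (sub_metric_lie M I))"

text \<open>
  The summands are indexed by \<open>1, \<dots>, k\<close>, with \<open>k = 0\<close> allowed for the zero algebra. The last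
  conjunct says that the sum of the ideals is direct and exhausts the carrier.
\<close>

definition orthogonal_decomposition ::
    "('k::field, 'g::ab_group_add) metric_lie \<Rightarrow> nat \<Rightarrow> (nat \<Rightarrow> 'g set) \<Rightarrow> bool" where
  "orthogonal_decomposition M k G \<longleftrightarrow>
     (\<forall>j\<in>{1..k}. lie_ideal M (G j)) \<and>
     (\<forall>i\<in>{1..k}. \<forall>j\<in>{1..k}. i \<noteq> j \<longrightarrow> (\<forall>x\<in>G i. \<forall>y\<in>G j. form M x y = 0)) \<and>
     (\<forall>x\<in>carrier M. \<exists>!f. f \<in> Pi\<^sub>E {1..k} G \<and> x = (\<Sum>j=1..k. f j))"

definition irreducible_decomposition ::
    "('k::field, 'g::ab_group_add) metric_lie \<Rightarrow> nat \<Rightarrow> (nat \<Rightarrow> 'g set) \<Rightarrow> bool" where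
  "irreducible_decomposition M k G \<longleftrightarrow>
     orthogonal_decomposition M k G \<and>
     (\<forall>j\<in>{1..k}. metric_factor M (G j) \<and> irreducible_metric_lie (sub_metric_lie M (G j)))"

definition orthogonal_biinvariant_complex_structure ::
    "(real, 'g::ab_group_add) metric_lie \<Rightarrow> ('g \<Rightarrow> 'g) \<Rightarrow> bool" where
  "orthogonal_biinvariant_complex_structure M J \<longleftrightarrow>
     (\<forall>x\<in>carrier M. J x \<in> carrier M) \<and>
     (\<forall>x\<in>carrier M. \<forall>y\<in>carrier M. J (x + y) = J x + J y) \<and>
     (\<forall>c. \<forall>x\<in>carrier M. J (scale M c x) = scale M c (J x)) \<and>
     (\<forall>x\<in>carrier M. J (J x) = - x) \<and>
     (\<forall>x\<in>carrier M. \<forall>y\<in>carrier M. J (bracket M x y) = bracket M (J x) y) \<and>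
     (\<forall>x\<in>carrier M. \<forall>y\<in>carrier M. form M (J x) (J y) = form M x y)"

text \<open>The complex metric Lie algebra \<open>(M, J)\<close>.\<close>

definition complex_metric_lie ::
    "(real, 'g::ab_group_add) metric_lie \<Rightarrow> ('g \<Rightarrow> 'g) \<Rightarrow> (complex, 'g) metric_lie" where
  "complex_metric_lie M J =
     \<lparr>carrier = carrier M,
      scale = (\<lambda>c x. scale M (Re c) x + scale M (Im c) (J x)),
      bracket = bracket M,
      form = (\<lambda>x y. (1/2) * (complex_of_real (form M x y) + \<i> * complex_of_real (form M x (J y))))\<rparr>"

text \<open>
  Hence the sub-object of \<open>(M, J)\<close> with carrier \<open>I\<close> is the pair of \<open>I\<close> and the restriction of \<open>J\<close>
  to \<open>I\<close>.
\<close>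

lemma sub_metric_lie_complex_metric_lie:
  "sub_metric_lie (complex_metric_lie M J) I = complex_metric_lie (sub_metric_lie M I) J"
  by (simp add: sub_metric_lie_def complex_metric_lie_def)

end

theory Submission
  imports Defs
begin

text \<open>
  The heart of the matter is a statement about one map at a time. Suppose that \<open>I\<close> is a factor whose
  complement is complementary in the linear sense, and that \<open>T\<close> commutes with all adjoint maps and
  is, up to a scalar, its own adjoint. For \<open>x \<in> I\<close> let \<open>w\<close> be the component of \<open>T x\<close> in the complement
  of \<open>I\<close>. If \<open>y\<close> lies in this complement, then \<open>[w, y] = [T x, y] = T [x, y] = 0\<close>, so \<open>w\<close> is
  central; moving \<open>T\<close> to the other side of the form shows that \<open>w\<close> is orthogonal to all brackets.
  The line spanned by such a vector is an abelian factor, and therefore \<open>w = 0\<close> when there are no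
  non-zero abelian factors. So \<open>T\<close> maps \<open>I\<close> into itself (lemma \<open>factor_invariant\<close>).

  This is used twice. With \<open>T = J\<close> it gives the \<open>J\<close>-invariance of the irreducible factors. With \<open>T\<close>
  the orthogonal projection onto another factor \<open>H\<close> it shows that an irreducible factor lies either in
  \<open>H\<close> or in its complement (lemma \<open>irreducible_factor_dichotomy\<close>), and the uniqueness of the
  decomposition into irreducible factors follows from this (lemma \<open>irreducible_decomposition_unique\<close>).

  It remains to compare \<open>\<gg>\<close> with \<open>(\<gg>, J)\<close>. On a \<open>J\<close>-invariant subspace, orthogonality for the
  Hermitian form and for the real form are the same, so the factors of \<open>(\<gg>, J)\<close> are exactly the
  \<open>J\<close>-invariant factors of \<open>\<gg>\<close>, and likewise for each \<open>J\<close>-invariant ideal (lemma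
  \<open>complex_metric_factor_iff\<close>). Hence \<open>(\<gg>, J)\<close> inherits the absence of abelian factors, the
  irreducibility of the \<open>\<gg>\<^sub>j\<close>, and the decomposition itself, which is then the only one by uniqueness.
\<close>

section \<open>Lie algebras with an anisotropic form\<close>

text \<open>
  Real and complex metric Lie algebras are treated together. All that the arguments on factors need is
  that the form is linear in the first argument, that orthogonality is a symmetric relation, and that
  no non-zero vector is orthogonal to itself.
\<close>

locale anisotropic_lie_algebra =
  fixes M :: "('k::field, 'g::ab_group_add) metric_lie"
  assumes lie: "lie_algebra M"
    and form_add: "\<lbrakk>x \<in> carrier M; y \<in> carrier M; z \<in> carrier M\<rbrakk>
          \<Longrightarrow> form M (x + y) z = form M x z + form M y z"
    and form_scale: "\<lbrakk>x \<in> carrier M; y \<in> carrier M\<rbrakk> \<Longrightarrow> form M (scale M c x) y = c * form M x y"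
    and orth_sym: "\<lbrakk>x \<in> carrier M; y \<in> carrier M; form M x y = 0\<rbrakk> \<Longrightarrow> form M y x = 0"
    and anisotropic: "\<lbrakk>x \<in> carrier M; form M x x = 0\<rbrakk> \<Longrightarrow> x = 0"
begin

sublocale V: vector_space "scale M"
  using lie by (simp add: lie_algebra_def)

lemma carrier_subspace: "V.subspace (carrier M)"
  using lie by (simp add: lie_algebra_def)

lemma carrier_closed [simp]:
  "0 \<in> carrier M"
  "\<lbrakk>x \<in> carrier M; y \<in> carrier M\<rbrakk> \<Longrightarrow> x + y \<in> carrier M"
  "\<lbrakk>x \<in> carrier M; y \<in> carrier M\<rbrakk> \<Longrightarrow> x - y \<in> carrier M"
  "x \<in> carrier M \<Longrightarrow> scale M c x \<in> carrier M"
  "\<lbrakk>x \<in> carrier M; y \<in> carrier M\<rbrakk> \<Longrightarrow> bracket M x y \<in> carrier M"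
  using carrier_subspace V.subspace_0 V.subspace_add V.subspace_diff V.subspace_scale lie
  by (simp_all add: lie_algebra_def)

lemma bracket_add:
  assumes "x \<in> carrier M" "y \<in> carrier M" "z \<in> carrier M"
  shows "bracket M (x + y) z = bracket M x z + bracket M y z"
    and "bracket M x (y + z) = bracket M x y + bracket M x z"
  using lie assms by (simp_all add: lie_algebra_def)

lemma bracket_scale:
  assumes "x \<in> carrier M" "y \<in> carrier M"
  shows "bracket M (scale M c x) y = scale M c (bracket M x y)"
    and "bracket M x (scale M c y) = scale M c (bracket M x y)"
  using lie assms by (simp_all add: lie_algebra_def)

lemma bracket_self: "x \<in> carrier M \<Longrightarrow> bracket M x x = 0"
  using lie by (simp add: lie_algebra_def)

lemma bracket_antisym:
  assumes "x \<in> carrier M" "y \<in> carrier M"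
  shows "bracket M x y = - bracket M y x"
proof -
  have "0 = bracket M (x + y) (x + y)"
    using assms by (simp add: bracket_self)
  also have "\<dots> = bracket M x y + bracket M y x"
    using assms bracket_self[of x] bracket_self[of y] by (simp add: bracket_add)
  finally show ?thesis
    by (metis eq_neg_iff_add_eq_0)
qed

lemma bracket_zero [simp]:
  assumes "x \<in> carrier M"
  shows "bracket M 0 x = 0" "bracket M x 0 = 0"
  using bracket_add(1)[of 0 0 x] bracket_add(2)[of x 0 0] assms by simp_all

lemma form_zero [simp]:
  assumes "x \<in> carrier M"
  shows "form M 0 x = 0" "form M x 0 = 0"
proof -
  show "form M 0 x = 0"
    using form_scale[of 0 x 0] assms by simp
  then show "form M x 0 = 0"
    using orth_sym assms by simp
qed

lemma orth_add_right:
  assumes "x \<in> carrier M" "y \<in> carrier M" "z \<in> carrier M" "form M x y = 0" "form M x z = 0"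
  shows "form M x (y + z) = 0"
  using assms by (intro orth_sym[of "y + z"]) (simp_all add: form_add orth_sym[of x])

lemma orth_complement_subset: "orth_complement M I \<subseteq> carrier M"
  by (auto simp: orth_complement_def)

lemma orth_complement_form:
  assumes "I \<subseteq> carrier M" "x \<in> I" "y \<in> orth_complement M I"
  shows "form M y x = 0" "form M x y = 0"
  using assms orth_sym[of y x] by (auto simp: orth_complement_def)

lemma orth_complement_subspace:
  assumes "I \<subseteq> carrier M"
  shows "V.subspace (orth_complement M I)"
  unfolding V.subspace_def
  using assms by (auto simp: orth_complement_def form_add form_scale subset_iff)

lemma orth_complement_disjoint:
  assumes "x \<in> I" "x \<in> orth_complement M I"
  shows "x = 0"
  using assms anisotropic by (auto simp: orth_complement_def)

lemma ideal_subspace: "lie_ideal M I \<Longrightarrow> V.subspace I"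
  and ideal_subset: "lie_ideal M I \<Longrightarrow> I \<subseteq> carrier M"
  and ideal_bracket_right: "\<lbrakk>lie_ideal M I; x \<in> carrier M; y \<in> I\<rbrakk> \<Longrightarrow> bracket M x y \<in> I"
  by (auto simp: lie_ideal_def)

lemma ideal_bracket_left:
  assumes "lie_ideal M I" "x \<in> I" "y \<in> carrier M"
  shows "bracket M x y \<in> I"
proof -
  have "- bracket M y x \<in> I"
    using assms by (intro V.subspace_neg ideal_subspace ideal_bracket_right)
  then show ?thesis
    using assms bracket_antisym[of x y] ideal_subset[OF assms(1)] by auto
qed

section \<open>Factors with a complement\<close>

text \<open>
  In finite dimension every factor splits off. Here this is a separate notion because the summands of
  an orthogonal decomposition come with the splitting, so that no orthogonal projection has to be
  constructed.
\<close>

definition splits_off :: "'g set \<Rightarrow> bool" where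
  "splits_off I \<longleftrightarrow> metric_factor M I \<and>
     (\<forall>x\<in>carrier M. \<exists>a\<in>I. \<exists>b\<in>orth_complement M I. x = a + b)"

lemma splits_off_ideal: "splits_off I \<Longrightarrow> lie_ideal M I"
  and splits_off_ideal_complement: "splits_off I \<Longrightarrow> lie_ideal M (orth_complement M I)"
  by (auto simp: splits_off_def metric_factor_def)

lemma splits_offE:
  assumes "splits_off I" "x \<in> carrier M"
  obtains a b where "a \<in> I" "b \<in> orth_complement M I" "x = a + b"
  using assms by (auto simp: splits_off_def)

lemma bracket_factor_complement:
  assumes "metric_factor M I" "x \<in> I" "y \<in> orth_complement M I"
  shows "bracket M x y = 0"
proof (rule orth_complement_disjoint)
  have id: "lie_ideal M I" "lie_ideal M (orth_complement M I)"
    using assms(1) by (auto simp: metric_factor_def)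
  show "bracket M x y \<in> I"
    using ideal_bracket_left[OF id(1) assms(2)] assms(3) orth_complement_subset by auto
  show "bracket M x y \<in> orth_complement M I"
    using ideal_bracket_right[OF id(2) _ assms(3)] assms(2) ideal_subset[OF id(1)] by auto
qed

lemma summand_splits_off:
  assumes "irreducible_decomposition M k G" "j \<in> {1..k}"
  shows "splits_off (G j)"
  unfolding splits_off_def
proof (intro conjI ballI)
  have dec: "orthogonal_decomposition M k G"
    using assms(1) by (simp add: irreducible_decomposition_def)
  have sub: "G i \<subseteq> carrier M" if "i \<in> {1..k}" for i
    using dec that ideal_subset by (auto simp: orthogonal_decomposition_def)
  show "metric_factor M (G j)"
    using assms by (simp add: irreducible_decomposition_def)
  fix x assume "x \<in> carrier M"
  then obtain f where f: "f \<in> Pi\<^sub>E {1..k} G" "x = (\<Sum>i=1..k. f i)"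
    using dec unfolding orthogonal_decomposition_def by blast
  have fG: "f i \<in> G i" if "i \<in> {1..k}" for i
    using f(1) that by (auto simp: PiE_iff)
  have "(\<Sum>i\<in>{1..k} - {j}. f i) \<in> orth_complement M (G j)"
  proof (rule V.subspace_sum)
    show "V.subspace (orth_complement M (G j))"
      using sub[OF assms(2)] by (rule orth_complement_subspace)
    fix i assume i: "i \<in> {1..k} - {j}"
    then have "f i \<in> carrier M"
      using fG sub by auto
    moreover have "form M (f i) y = 0" if "y \<in> G j" for y
      using dec i fG[of i] assms(2) that unfolding orthogonal_decomposition_def by blast
    ultimately show "f i \<in> orth_complement M (G j)"
      by (simp add: orth_complement_def)
  qed
  moreover have "x = f j + (\<Sum>i\<in>{1..k} - {j}. f i)"
    unfolding f(2) using assms(2) by (intro sum.remove) auto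
  ultimately show "\<exists>a\<in>G j. \<exists>b\<in>orth_complement M (G j). x = a + b"
    using fG[OF assms(2)] by blast
qed

text \<open>
  The line spanned by \<open>w\<close> is an ideal because \<open>w\<close> is central, and its complement is one because it
  contains all brackets; so this line is an abelian factor.
\<close>

lemma central_orth_brackets_zero:
  assumes na: "no_nonzero_abelian_factor M"
    and w: "w \<in> carrier M"
    and central: "\<And>y. y \<in> carrier M \<Longrightarrow> bracket M w y = 0"
    and orth: "\<And>u v. \<lbrakk>u \<in> carrier M; v \<in> carrier M\<rbrakk> \<Longrightarrow> form M w (bracket M u v) = 0"
  shows "w = 0"
proof (rule ccontr)
  assume "w \<noteq> 0"
  let ?L = "range (\<lambda>c. scale M c w)"
  have L: "?L \<subseteq> carrier M"
    using w by auto
  have central': "bracket M y w = 0" if "y \<in> carrier M" for y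
    using bracket_antisym[OF that w] central[OF that] by simp
  have "V.subspace ?L"
    unfolding V.subspace_def
    by (auto simp flip: V.scale_left_distrib intro: range_eqI[of _ _ 0])
  then have "lie_ideal M ?L"
    using L w central' by (auto simp: lie_ideal_def bracket_scale intro: range_eqI[of _ _ 0])
  moreover have "lie_ideal M (orth_complement M ?L)"
  proof -
    have "bracket M x y \<in> orth_complement M ?L" if "x \<in> carrier M" "y \<in> carrier M" for x y
    proof -
      have "form M (scale M c w) (bracket M x y) = 0" for c
        using that w orth by (simp add: form_scale)
      then show ?thesis
        using that w orth_sym by (auto simp: orth_complement_def)
    qed
    then show ?thesis
      using orth_complement_subspace[OF L] orth_complement_subset
      by (auto simp: lie_ideal_def)
  qed
  moreover have "?L \<noteq> {0}"
    using \<open>w \<noteq> 0\<close> rangeI[of "\<lambda>c. scale M c w" 1] by auto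
  moreover have "abelian (sub_metric_lie M ?L)"
    using w central by (auto simp: abelian_def sub_metric_lie_def bracket_scale)
  ultimately show False
    using na by (auto simp: no_nonzero_abelian_factor_def metric_factor_def)
qed

text \<open>
  The condition \<open>adj\<close> is the part of self-adjointness up to a scalar that refers to orthogonality
  only; it covers both the skew-adjoint \<open>J\<close> and the self-adjoint projections.
\<close>

lemma factor_invariant:
  assumes na: "no_nonzero_abelian_factor M"
    and I: "splits_off I"
    and T: "\<And>x. x \<in> carrier M \<Longrightarrow> T x \<in> carrier M"
    and T_bracket: "\<And>x y. \<lbrakk>x \<in> carrier M; y \<in> carrier M\<rbrakk> \<Longrightarrow> T (bracket M x y) = bracket M (T x) y"
    and adj: "\<And>x y. \<lbrakk>x \<in> carrier M; y \<in> carrier M; form M x (T y) = 0\<rbrakk> \<Longrightarrow> form M (T x) y = 0"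
    and x: "x \<in> I"
  shows "T x \<in> I"
proof -
  note idI = splits_off_ideal[OF I] and idC = splits_off_ideal_complement[OF I]
  note IM = subsetD[OF ideal_subset[OF idI]] and CM = subsetD[OF orth_complement_subset[of I]]
  have fac: "metric_factor M I"
    using I by (simp add: splits_off_def)
  obtain a w where a: "a \<in> I" and w: "w \<in> orth_complement M I" and Tx: "T x = a + w"
    using splits_offE[OF I T[OF IM[OF x]]] by metis
  have T0: "T 0 = 0"
    using T_bracket[of 0 0] T[of 0] by simp
  have w_C: "bracket M w y = 0" if y: "y \<in> orth_complement M I" for y
  proof -
    have "bracket M w y = bracket M (T x) y"
      using a w y IM CM by (simp add: Tx bracket_add bracket_factor_complement[OF fac])
    also have "\<dots> = T (bracket M x y)"
      using x y IM CM by (simp add: T_bracket)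
    also have "\<dots> = 0"
      by (simp add: bracket_factor_complement[OF fac x y] T0)
    finally show ?thesis .
  qed
  have w_I: "bracket M w y = 0" if y: "y \<in> I" for y
    using bracket_antisym[of w y] bracket_factor_complement[OF fac y w] CM[OF w] IM[OF y] by simp
  have orth_I: "form M w y = 0" if "y \<in> I" for y
    using w that by (simp add: orth_complement_def)
  have orth_C: "form M w (bracket M u v) = 0"
    if u: "u \<in> carrier M" and v: "v \<in> orth_complement M I" for u v
  proof -
    have mem: "bracket M z v \<in> orth_complement M I" if "z \<in> carrier M" for z
      using ideal_bracket_right[OF idC that v] .
    note orth_of = orth_complement_form(2)[OF ideal_subset[OF idI]]
    have "form M x (T (bracket M u v)) = 0"
      using orth_of[OF x mem[OF T[OF u]]] u v CM by (simp add: T_bracket)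
    then have "form M (T x) (bracket M u v) = 0"
      using adj x u v IM CM by simp
    then show ?thesis
      using orth_of[OF a mem[OF u]] a w u v IM CM by (simp add: Tx form_add)
  qed
  have "w = 0"
  proof (rule central_orth_brackets_zero[OF na CM[OF w]])
    fix y assume "y \<in> carrier M"
    then obtain b c where "b \<in> I" "c \<in> orth_complement M I" "y = b + c"
      using splits_offE[OF I] by metis
    then show "bracket M w y = 0"
      using w_I w_C w IM CM by (simp add: bracket_add)
  next
    fix u v assume u: "u \<in> carrier M" and v: "v \<in> carrier M"
    obtain b c where bc: "b \<in> I" "c \<in> orth_complement M I" "v = b + c"
      using splits_offE[OF I v] by metis
    have "form M w (bracket M u b + bracket M u c) = 0"
      using w u bc IM CM orth_I[OF ideal_bracket_right[OF idI u bc(1)]] orth_C[OF u bc(2)]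
      by (intro orth_add_right) simp_all
    then show "form M w (bracket M u v) = 0"
      using u bc IM CM by (simp add: bracket_add)
  qed
  then show ?thesis
    using a Tx by simp
qed

section \<open>Uniqueness of the irreducible factors\<close>

text \<open>
  The projection \<open>P\<close> onto \<open>H\<close> commutes with the adjoint maps because \<open>H\<close> and its complement are ideals,
  so it maps \<open>A\<close> into itself. Then \<open>A \<inter> H\<close> is a factor of \<open>A\<close>, hence \<open>0\<close> or all of \<open>A\<close>.
\<close>

lemma irreducible_factor_dichotomy:
  assumes na: "no_nonzero_abelian_factor M"
    and A: "splits_off A" and irr: "irreducible_metric_lie (sub_metric_lie M A)"
    and H: "splits_off H"
  shows "A \<subseteq> H \<or> A \<subseteq> orth_complement M H"
proof -
  note idA = splits_off_ideal[OF A] and idH = splits_off_ideal[OF H]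
    and idC = splits_off_ideal_complement[OF H]
  note AM = subsetD[OF ideal_subset[OF idA]] and HM = subsetD[OF ideal_subset[OF idH]]
    and CM = subsetD[OF orth_complement_subset[of H]]
  note HC = orth_complement_form[OF ideal_subset[OF idH]]
  have "\<forall>x\<in>carrier M. \<exists>a. a \<in> H \<and> x - a \<in> orth_complement M H"
    using splits_offE[OF H] by (metis add_diff_cancel_left')
  then obtain P where P: "\<And>x. x \<in> carrier M \<Longrightarrow> P x \<in> H"
      and Q: "\<And>x. x \<in> carrier M \<Longrightarrow> x - P x \<in> orth_complement M H"
    by metis
  have PM: "P x \<in> carrier M" if "x \<in> carrier M" for x
    using HM[OF P[OF that]] .
  have P_bracket: "P (bracket M x y) = bracket M (P x) y"
    if x: "x \<in> carrier M" and y: "y \<in> carrier M" for x y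
  proof -
    let ?z = "P (bracket M x y) - bracket M (P x) y"
    have "?z \<in> H"
      using P x y by (intro V.subspace_diff[OF ideal_subspace[OF idH]] ideal_bracket_left[OF idH] P)
        simp_all
    moreover have "?z = bracket M (x - P x) y - (bracket M x y - P (bracket M x y))"
      using bracket_add(1)[of "P x" "x - P x" y] x y PM by simp
    moreover have "\<dots> \<in> orth_complement M H"
      using Q x y by (intro V.subspace_diff[OF ideal_subspace[OF idC]] ideal_bracket_left[OF idC] Q)
        simp_all
    ultimately show ?thesis
      using orth_complement_disjoint[of ?z H] by (metis eq_iff_diff_eq_0)
  qed
  have P_adj: "form M (P x) y = 0"
    if x: "x \<in> carrier M" and y: "y \<in> carrier M" and 0: "form M x (P y) = 0" for x y
  proof -
    have "form M (P x) (P y) = 0"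
      using form_add[of "P x" "x - P x" "P y"] x y PM 0 HC(1)[OF P[OF y] Q[OF x]] by simp
    then show ?thesis
      using orth_add_right[of "P x" "P y" "y - P y"] x y PM HC(2)[OF P[OF x] Q[OF y]] by simp
  qed
  have PA: "P x \<in> A" if "x \<in> A" for x
    using factor_invariant[where T = P, OF na A _ P_bracket P_adj that] PM by blast
  \<comment> \<open>As \<open>A\<close> is stable under the projection, the complement of \<open>A \<inter> H\<close> in \<open>A\<close> is \<open>A \<inter> H\<^sup>\<bottom>\<close>.\<close>
  have compl: "orth_complement (sub_metric_lie M A) (A \<inter> H) = A \<inter> orth_complement M H"
  proof (intro equalityI subsetI)
    fix x assume x: "x \<in> orth_complement (sub_metric_lie M A) (A \<inter> H)"
    then have xA: "x \<in> A" and xo: "form M x (P x) = 0"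
      using PA P AM by (auto simp: orth_complement_def sub_metric_lie_def)
    have "form M (P x) (P x) = 0"
      using form_add[of "P x" "x - P x" "P x"] AM[OF xA] PM xo HC(1)[OF P Q] by simp
    then have "P x = 0"
      using anisotropic PM AM[OF xA] by blast
    then show "x \<in> A \<inter> orth_complement M H"
      using Q[OF AM[OF xA]] xA by simp
  next
    fix x assume "x \<in> A \<inter> orth_complement M H"
    then show "x \<in> orth_complement (sub_metric_lie M A) (A \<inter> H)"
      by (auto simp: orth_complement_def sub_metric_lie_def)
  qed
  have "lie_ideal (sub_metric_lie M A) (A \<inter> K)" if "lie_ideal M K" for K
    using that idA V.subspace_inter[OF ideal_subspace[OF idA] ideal_subspace[OF that]] AM
    by (auto simp: lie_ideal_def sub_metric_lie_def)
  then have "metric_factor (sub_metric_lie M A) (A \<inter> H)"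
    using idH idC compl by (simp add: metric_factor_def)
  then consider "A \<inter> H = {0}" | "A \<inter> H = A"
    using irr by (auto simp: irreducible_metric_lie_def sub_metric_lie_def)
  then show ?thesis
  proof cases
    case 1
    then have "P x = 0" if "x \<in> A" for x
      using that P PA AM by blast
    then show ?thesis
      using Q AM by fastforce
  qed auto
qed

text \<open>If \<open>A\<close> were contained in no summand, it would be orthogonal to all of them, and so to itself.\<close>

lemma irreducible_factor_subset_summand:
  assumes na: "no_nonzero_abelian_factor M"
    and A: "splits_off A" and irr: "irreducible_metric_lie (sub_metric_lie M A)"
    and H: "irreducible_decomposition M n H"
  obtains i where "i \<in> {1..n}" "A \<subseteq> H i"
proof (rule ccontr)
  assume "\<not> thesis"
  then have "\<not> A \<subseteq> H i" if "i \<in> {1..n}" for i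
    using that \<open>\<And>i. \<lbrakk>i \<in> {1..n}; A \<subseteq> H i\<rbrakk> \<Longrightarrow> thesis\<close> by blast
  then have AC: "A \<subseteq> orth_complement M (H i)" if "i \<in> {1..n}" for i
    using irreducible_factor_dichotomy[OF na A irr summand_splits_off[OF H that]] that by blast
  note AM = subsetD[OF ideal_subset[OF splits_off_ideal[OF A]]]
  have "x = 0" if x: "x \<in> A" for x
  proof (rule anisotropic[OF AM[OF x]])
    have "\<exists>!f. f \<in> Pi\<^sub>E {1..n} H \<and> x = (\<Sum>i=1..n. f i)"
      using H AM[OF x] by (simp add: irreducible_decomposition_def orthogonal_decomposition_def)
    then obtain f where f: "f \<in> Pi\<^sub>E {1..n} H" "x = (\<Sum>i=1..n. f i)"
      by blast
    have "(\<Sum>i=1..n. f i) \<in> orth_complement M {x}"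
    proof (rule V.subspace_sum)
      show "V.subspace (orth_complement M {x})"
        using AM[OF x] by (intro orth_complement_subspace) simp
      fix i assume i: "i \<in> {1..n}"
      then have fi: "f i \<in> H i"
        using f(1) by (auto simp: PiE_iff)
      then have "f i \<in> carrier M"
        using ideal_subset[OF splits_off_ideal[OF summand_splits_off[OF H i]]] by auto
      moreover have "form M x (f i) = 0"
        using AC[OF i] x fi by (auto simp: orth_complement_def)
      ultimately show "f i \<in> orth_complement M {x}"
        using orth_sym[of x "f i"] AM[OF x] by (simp add: orth_complement_def)
    qed
    then show "form M x x = 0"
      using f(2) by (simp add: orth_complement_def)
  qed
  then have "A \<subseteq> {0}"
    by auto
  moreover have "0 \<in> A"
    using V.subspace_0[OF ideal_subspace[OF splits_off_ideal[OF A]]] .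
  ultimately show False
    using irr by (auto simp: irreducible_metric_lie_def sub_metric_lie_def)
qed

text \<open>
  Each \<open>G j\<close> lies in some \<open>H i\<close>, which in turn lies in some \<open>G l\<close>. Distinct summands of one
  decomposition are orthogonal, so \<open>l = j\<close> and both inclusions are equalities.
\<close>

lemma irreducible_decomposition_subset:
  assumes na: "no_nonzero_abelian_factor M"
    and G: "irreducible_decomposition M k G" and H: "irreducible_decomposition M n H"
  shows "G ` {1..k} \<subseteq> H ` {1..n}"
proof (intro image_subsetI)
  have irr: "irreducible_metric_lie (sub_metric_lie M (G j))" if "j \<in> {1..k}" for j
    using G that by (simp add: irreducible_decomposition_def)
  fix j assume j: "j \<in> {1..k}"
  obtain i where i: "i \<in> {1..n}" "G j \<subseteq> H i"
    using irreducible_factor_subset_summand[OF na summand_splits_off[OF G j] irr[OF j] H] .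
  have "irreducible_metric_lie (sub_metric_lie M (H i))"
    using H i(1) by (simp add: irreducible_decomposition_def)
  then obtain l where l: "l \<in> {1..k}" "H i \<subseteq> G l"
    using irreducible_factor_subset_summand[OF na summand_splits_off[OF H i(1)] _ G] by blast
  have "l = j"
  proof (rule ccontr)
    assume "l \<noteq> j"
    then have "form M x x = 0" if "x \<in> G j" for x
      using that i l j G
      unfolding irreducible_decomposition_def orthogonal_decomposition_def by blast
    moreover note idG = splits_off_ideal[OF summand_splits_off[OF G j]]
    ultimately have "G j \<subseteq> {0}"
      using anisotropic ideal_subset[OF idG] by blast
    moreover have "0 \<in> G j"
      using V.subspace_0[OF ideal_subspace[OF idG]] .
    ultimately show False
      using irr[OF j] by (auto simp: irreducible_metric_lie_def sub_metric_lie_def)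
  qed
  then show "G j \<in> H ` {1..n}"
    using i l by blast
qed

lemma irreducible_decomposition_unique:
  assumes "no_nonzero_abelian_factor M"
    and "irreducible_decomposition M k G" and "irreducible_decomposition M n H"
  shows "H ` {1..n} = G ` {1..k}"
  using assms irreducible_decomposition_subset by (intro equalityI)

end

lemma real_metric_lie_algebra_anisotropic:
  assumes "real_metric_lie_algebra M"
  shows "anisotropic_lie_algebra M"
proof
  note M = assms[unfolded real_metric_lie_algebra_def]
  show "lie_algebra M"
    using M by blast
  fix x y z c
  assume x: "x \<in> carrier M"
  show "x = 0" if "form M x x = 0"
    using M x that by (metis less_irrefl)
  assume y: "y \<in> carrier M"
  show "form M (scale M c x) y = c * form M x y"
    using M x y by blast
  show "form M y x = 0" if "form M x y = 0"
    using M x y that by (metis)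
  assume "z \<in> carrier M"
  then show "form M (x + y) z = form M x z + form M y z"
    using M x y by blast
qed

lemma complex_metric_lie_algebra_anisotropic:
  assumes "complex_metric_lie_algebra M"
  shows "anisotropic_lie_algebra M"
proof
  note M = assms[unfolded complex_metric_lie_algebra_def]
  show "lie_algebra M"
    using M by blast
  fix x y z c
  assume x: "x \<in> carrier M"
  show "x = 0" if "form M x x = 0"
    using M x that by (metis less_irrefl zero_complex.sel(1))
  assume y: "y \<in> carrier M"
  show "form M (scale M c x) y = c * form M x y"
    using M x y by blast
  show "form M y x = 0" if "form M x y = 0"
    using M x y that by (metis complex_cnj_zero)
  assume "z \<in> carrier M"
  then show "form M (x + y) z = form M x z + form M y z"
    using M x y by blast
qed

section \<open>The complex metric Lie algebra of a complex structure\<close>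

text \<open>
  The carrier is the whole type because a vector space structure in the sense of \<open>vector_space\<close> lives
  on a type, whereas \<open>J\<close> is linear on the carrier only.
\<close>

locale complex_structure =
  fixes M :: "(real, 'g::ab_group_add) metric_lie" and J :: "'g \<Rightarrow> 'g"
  assumes metric: "real_metric_lie_algebra M"
    and carrier_UNIV: "carrier M = UNIV"
    and structure_J: "orthogonal_biinvariant_complex_structure M J"
begin

sublocale anisotropic_lie_algebra M
  using metric by (rule real_metric_lie_algebra_anisotropic)

lemma J_add: "J (x + y) = J x + J y"
  and J_scale: "J (scale M c x) = scale M c (J x)"
  and J_J: "J (J x) = - x"
  and J_bracket: "J (bracket M x y) = bracket M (J x) y"
  and J_form: "form M (J x) (J y) = form M x y"
  using structure_J by (simp_all add: orthogonal_biinvariant_complex_structure_def carrier_UNIV)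

lemma form_sym: "form M y x = form M x y"
  using metric by (simp add: real_metric_lie_algebra_def carrier_UNIV)

lemma form_minus: "form M (- x) y = - form M x y"
  using form_add[of x "- x" y] form_zero(1)[of y] by (simp add: carrier_UNIV)

lemma J_skew: "form M (J x) y = - form M x (J y)"
proof -
  have "form M (J x) y = form M (J (J x)) (J y)"
    by (simp add: J_form)
  then show ?thesis
    by (simp add: J_J form_minus)
qed

lemma J_bracket_right: "J (bracket M x y) = bracket M x (J y)"
proof -
  have J_minus: "J (- z) = - J z" for z
    using J_scale[of "-1" z] by simp
  show ?thesis
    using bracket_antisym[of x y] bracket_antisym[of x "J y"]
    by (simp add: carrier_UNIV J_minus J_bracket)
qed

lemma J_image_eq:
  assumes "V.subspace I" and "\<And>x. x \<in> I \<Longrightarrow> J x \<in> I"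
  shows "J ` I = I"
proof
  show "I \<subseteq> J ` I"
  proof
    fix x assume "x \<in> I"
    then have "J (- x) \<in> I"
      using assms V.subspace_neg by blast
    moreover have "J (J (- x)) = x"
      by (simp add: J_J)
    ultimately show "x \<in> J ` I"
      by (metis image_eqI)
  qed
qed (use assms in auto)

lemma complex_vector_space: "vector_space (scale (complex_metric_lie M J))"
  by unfold_locales
    (simp_all add: complex_metric_lie_def V.scale_right_distrib V.scale_left_distrib
      V.scale_left_diff_distrib J_add J_scale J_J algebra_simps)

sublocale C: vector_space "scale (complex_metric_lie M J)"
  by (rule complex_vector_space)

lemma complex_scale_real: "scale (complex_metric_lie M J) (complex_of_real r) x = scale M r x"
  by (simp add: complex_metric_lie_def)

lemma complex_scale_i: "scale (complex_metric_lie M J) \<i> x = J x"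
  by (simp add: complex_metric_lie_def)

lemma complex_subspace_iff: "C.subspace I \<longleftrightarrow> V.subspace I \<and> (\<forall>x\<in>I. J x \<in> I)"
proof
  assume I: "C.subspace I"
  show "V.subspace I \<and> (\<forall>x\<in>I. J x \<in> I)"
    unfolding V.subspace_def
    using C.subspace_0[OF I] C.subspace_add[OF I] C.subspace_scale[OF I]
      complex_scale_real complex_scale_i by metis
next
  assume "V.subspace I \<and> (\<forall>x\<in>I. J x \<in> I)"
  then show "C.subspace I"
    unfolding C.subspace_def
    by (auto simp: complex_metric_lie_def V.subspace_0 V.subspace_add V.subspace_scale)
qed

lemma complex_form_eq_0_iff:
  "form (complex_metric_lie M J) x y = 0 \<longleftrightarrow> form M x y = 0 \<and> form M x (J y) = 0"
  by (simp add: complex_metric_lie_def complex_eq_iff)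

lemma complex_metric: "complex_metric_lie_algebra (complex_metric_lie M J)"
proof -
  obtain B where B: "finite B" "V.span B = UNIV"
    using lie by (auto simp: lie_algebra_def carrier_UNIV)
  have "V.span B \<subseteq> C.span B"
    using complex_subspace_iff[of "C.span B"] C.span_superset
    by (intro V.span_minimal) auto
  then have "\<exists>B. finite B \<and> C.span B = carrier (complex_metric_lie M J)"
    using B by (auto simp: complex_metric_lie_def carrier_UNIV)
  moreover have "C.subspace (carrier (complex_metric_lie M J))"
    unfolding complex_subspace_iff by (simp add: complex_metric_lie_def carrier_UNIV)
  ultimately have lieC: "lie_algebra (complex_metric_lie M J)"
    using lie complex_vector_space unfolding lie_algebra_def
    by (simp add: complex_metric_lie_def carrier_UNIV bracket_add bracket_scale
        J_bracket J_bracket_right[symmetric])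
  have form_add_left: "form M (x + y) z = form M x z + form M y z"
    and form_scale_left: "form M (scale M r x) y = r * form M x y" for x y z r
    by (simp_all add: form_add form_scale carrier_UNIV)
  have pos: "form M x x > 0" if "x \<noteq> 0" for x
    using metric that by (simp add: real_metric_lie_algebra_def carrier_UNIV)
  have herm: "form M y (J x) = - form M x (J y)" for x y
    using J_skew[of x y] form_sym[of y "J x"] by simp
  let ?C = "complex_metric_lie M J"
  have "form ?C (x + y) z = form ?C x z + form ?C y z" for x y z
    by (simp add: complex_metric_lie_def form_add_left add_divide_distrib algebra_simps)
  moreover have "form ?C (scale ?C c x) y = c * form ?C x y" for c x y
    using J_skew[of x y]
    by (simp add: complex_metric_lie_def form_add_left form_scale_left J_form complex_eq_iff
        field_simps)
  moreover have "form ?C y x = cnj (form ?C x y)" for x y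
    using herm[of y x] form_sym[of y x] by (simp add: complex_metric_lie_def complex_eq_iff)
  moreover have "Re (form ?C x x) > 0" if "x \<noteq> 0" for x
    using pos[OF that] by (simp add: complex_metric_lie_def)
  ultimately show ?thesis
    using lieC unfolding complex_metric_lie_algebra_def by blast
qed

text \<open>
  Orthogonality to a \<open>J\<close>-invariant set means the same for both forms, by \<open>complex_form_eq_0_iff\<close>, and
  the complement is again \<open>J\<close>-invariant because \<open>J\<close> is skew-adjoint. The case \<open>A = UNIV\<close> is that of
  the whole algebra.
\<close>

lemma complex_metric_factor_iff:
  assumes A: "\<And>x. x \<in> A \<Longrightarrow> J x \<in> A"
  shows "metric_factor (sub_metric_lie (complex_metric_lie M J) A) I \<longleftrightarrow>
    metric_factor (sub_metric_lie M A) I \<and> (\<forall>x\<in>I. J x \<in> I)"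
proof -
  let ?C = "sub_metric_lie (complex_metric_lie M J) A" and ?R = "sub_metric_lie M A"
  have ideal_iff: "lie_ideal ?C K \<longleftrightarrow> lie_ideal ?R K \<and> (\<forall>x\<in>K. J x \<in> K)" for K
    using complex_subspace_iff[of K]
    by (auto simp: lie_ideal_def sub_metric_lie_def) (auto simp: complex_metric_lie_def)
  have "orth_complement ?C I = orth_complement ?R I"
    and "\<forall>x\<in>orth_complement ?R I. J x \<in> orth_complement ?R I" if "\<forall>x\<in>I. J x \<in> I"
    using that A complex_form_eq_0_iff
    by (auto simp: orth_complement_def sub_metric_lie_def J_skew complex_metric_lie_def)
  then show ?thesis
    unfolding metric_factor_def ideal_iff by auto
qed

lemma complex_metric_factor_UNIV_iff:
  "metric_factor (complex_metric_lie M J) I \<longleftrightarrow> metric_factor M I \<and> (\<forall>x\<in>I. J x \<in> I)"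
proof -
  have "sub_metric_lie M UNIV = M"
    "sub_metric_lie (complex_metric_lie M J) UNIV = complex_metric_lie M J"
    using carrier_UNIV by (simp_all add: sub_metric_lie_def complex_metric_lie_def)
  then show ?thesis
    using complex_metric_factor_iff[of UNIV I] by simp
qed

lemma complex_no_nonzero_abelian_factor:
  assumes "no_nonzero_abelian_factor M"
  shows "no_nonzero_abelian_factor (complex_metric_lie M J)"
proof -
  have "abelian (sub_metric_lie (complex_metric_lie M J) I) \<longleftrightarrow> abelian (sub_metric_lie M I)" for I
    by (simp add: abelian_def sub_metric_lie_def complex_metric_lie_def)
  then show ?thesis
    using assms by (simp add: no_nonzero_abelian_factor_def complex_metric_factor_UNIV_iff)
qed

lemma summand_J_invariant:
  assumes na: "no_nonzero_abelian_factor M" and G: "irreducible_decomposition M k G"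
    and j: "j \<in> {1..k}" and x: "x \<in> G j"
  shows "J x \<in> G j"
  using factor_invariant[where T = J, OF na summand_splits_off[OF G j] _ _ _ x]
  by (simp add: carrier_UNIV J_bracket J_skew)

lemma complex_irreducible_decomposition:
  assumes na: "no_nonzero_abelian_factor M" and G: "irreducible_decomposition M k G"
  shows "irreducible_decomposition (complex_metric_lie M J) k G"
proof -
  note J_inv = summand_J_invariant[OF na G]
  have fac: "metric_factor (complex_metric_lie M J) (G j)" if "j \<in> {1..k}" for j
    using G that J_inv by (simp add: irreducible_decomposition_def complex_metric_factor_UNIV_iff)
  have "irreducible_metric_lie (sub_metric_lie (complex_metric_lie M J) (G j))"
    if j: "j \<in> {1..k}" for j
  proof -
    have "irreducible_metric_lie (sub_metric_lie M (G j))"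
      using G j by (simp add: irreducible_decomposition_def)
    then show ?thesis
      using complex_metric_factor_iff[OF J_inv[OF j]]
      by (simp add: irreducible_metric_lie_def) (simp add: sub_metric_lie_def)
  qed
  moreover have "orthogonal_decomposition (complex_metric_lie M J) k G"
    unfolding orthogonal_decomposition_def
  proof (intro conjI ballI impI)
    have dec: "orthogonal_decomposition M k G"
      using G by (simp add: irreducible_decomposition_def)
    show "lie_ideal (complex_metric_lie M J) (G j)" if "j \<in> {1..k}" for j
      using fac[OF that] by (simp add: metric_factor_def)
    show "form (complex_metric_lie M J) x y = 0"
      if "i \<in> {1..k}" "j \<in> {1..k}" "i \<noteq> j" "x \<in> G i" "y \<in> G j" for i j x y
      using dec that J_inv by (simp add: orthogonal_decomposition_def complex_form_eq_0_iff)
    show "\<exists>!f. f \<in> Pi\<^sub>E {1..k} G \<and> x = (\<Sum>j=1..k. f j)" for x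
      using dec by (simp add: orthogonal_decomposition_def carrier_UNIV)
  qed
  ultimately show ?thesis
    using fac by (simp add: irreducible_decomposition_def)
qed

end

theorem theorem4p11:
  fixes \<gg> :: "(real, 'g::ab_group_add) metric_lie"
    and k :: nat and G :: "nat \<Rightarrow> 'g set" and J :: "'g \<Rightarrow> 'g"
  assumes "real_metric_lie_algebra \<gg>"
    and "carrier \<gg> = UNIV"
    and "no_nonzero_abelian_factor \<gg>"
    and "irreducible_decomposition \<gg> k G"
    and "orthogonal_biinvariant_complex_structure \<gg> J"
  shows "(\<forall>j\<in>{1..k}. J ` G j = G j) \<and>
    complex_metric_lie_algebra (complex_metric_lie \<gg> J) \<and>
    no_nonzero_abelian_factor (complex_metric_lie \<gg> J) \<and>
    irreducible_decomposition (complex_metric_lie \<gg> J) k G \<and>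
    (\<forall>n H. irreducible_decomposition (complex_metric_lie \<gg> J) n H \<longrightarrow> H ` {1..n} = G ` {1..k})"
proof -
  interpret complex_structure \<gg> J
    using assms by unfold_locales
  interpret CA: anisotropic_lie_algebra "complex_metric_lie \<gg> J"
    using complex_metric by (rule complex_metric_lie_algebra_anisotropic)
  have na: "no_nonzero_abelian_factor (complex_metric_lie \<gg> J)"
    using assms(3) by (rule complex_no_nonzero_abelian_factor)
  have dec: "irreducible_decomposition (complex_metric_lie \<gg> J) k G"
    using assms(3,4) by (rule complex_irreducible_decomposition)
  have "J ` G j = G j" if j: "j \<in> {1..k}" for j
  proof (rule J_image_eq)
    show "V.subspace (G j)"
      using summand_splits_off[OF assms(4) j] by (intro ideal_subspace splits_off_ideal)
    show "J x \<in> G j" if "x \<in> G j" for x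
      using summand_J_invariant[OF assms(3,4) j that] .
  qed
  then show ?thesis
    using complex_metric na dec CA.irreducible_decomposition_unique[OF na dec] by blast
qed

end
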